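(* Let $X$ be a topological space. The following are equivalent: (1) $X$ is a partition space. (2) Every $\mathcal{AB}$-set in $X$ is clopen. (3) Every $\mathcal{AB}$-set in $X$ is closed. (3') Every $\mathcal{AB}$-set in $X$ is preclosed.
   Context: For a subset $A$ of a topological space $X$, $\mathrm{Int}\,A$ denotes the interior and $\overline{A}$ the closure of $A$ in $X$. $A$ is semi-open if $A \subseteq \overline{\mathrm{Int}\,A}$; semi-closed if its complement is semi-open; semi-regular if it is both semi-open and semi-closed. $A$ is an $\mathcal{AB}$-set if $A = U \cap V$ with $U$ open and $V$ semi-regular. $A$ is preopen if $A \subseteq \mathrm{Int}\,\overline{A}$, and preclosed if its complement is preopen (equivalently $\overline{\mathrm{Int}\,A} \subseteq A$). A space $X$ is a partition space if every open subset of $X$ is closed. No separation axioms are assumed. *)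

theory Defs
  imports "HOL-Analysis.Abstract_Topology"
begin

text \<open>Spaces are carrier-based topologies, so the empty space is included.  In all the
  notions below the sets involved are subsets of \<^term>\<open>topspace X\<close>: for \<open>semi_openin\<close> and
  \<open>preopenin\<close> this follows, because closures and interiors lie in \<^term>\<open>topspace X\<close>;
  for the complementary notions it is required explicitly, as in \<^const>\<open>closedin\<close>.\<close>

definition semi_openin :: "'a topology \<Rightarrow> 'a set \<Rightarrow> bool" where
  "semi_openin X A \<longleftrightarrow> A \<subseteq> X closure_of (X interior_of A)"

definition semi_closedin :: "'a topology \<Rightarrow> 'a set \<Rightarrow> bool" where
  "semi_closedin X A \<longleftrightarrow> A \<subseteq> topspace X \<and> semi_openin X (topspace X - A)"

definition semi_regularin :: "'a topology \<Rightarrow> 'a set \<Rightarrow> bool" where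
  "semi_regularin X A \<longleftrightarrow> semi_openin X A \<and> semi_closedin X A"

definition AB_setin :: "'a topology \<Rightarrow> 'a set \<Rightarrow> bool" where
  "AB_setin X A \<longleftrightarrow> (\<exists>U V. openin X U \<and> semi_regularin X V \<and> A = U \<inter> V)"

definition preopenin :: "'a topology \<Rightarrow> 'a set \<Rightarrow> bool" where
  "preopenin X A \<longleftrightarrow> A \<subseteq> X interior_of (X closure_of A)"

definition preclosedin :: "'a topology \<Rightarrow> 'a set \<Rightarrow> bool" where
  "preclosedin X A \<longleftrightarrow> A \<subseteq> topspace X \<and> preopenin X (topspace X - A)"

definition partition_space :: "'a topology \<Rightarrow> bool" where
  "partition_space X \<longleftrightarrow> (\<forall>U. openin X U \<longrightarrow> closedin X U)"

end

theory Submission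
  imports Defs
begin

text \<open>In a partition space interiors are closed, so the closure in the definition of semi-open
  does nothing and semi-open sets are open; an AB-set is then an intersection of two open sets,
  hence clopen (\<open>partition_space_AB_setin_imp_clopen\<close>). Closed sets are preclosed, so
  the conditions on AB-sets weaken from clopen to closed to preclosed. The weakest still suffices:
  every open set is an AB-set, and an open preclosed set is closed
  (\<open>AB_setin_preclosedin_imp_partition_space\<close>).\<close>

lemma semi_openin_topspace: "semi_openin X (topspace X)"
  by (simp add: semi_openin_def)

lemma semi_regularin_topspace: "semi_regularin X (topspace X)"
  \<comment> \<open>The first \<open>simp\<close> leaves the complement, the empty set, to be shown
    semi-open.\<close>
  by (simp add: semi_regularin_def semi_closedin_def semi_openin_topspace) (simp add: semi_openin_def)

text \<open>The whole space serves as the semi-regular factor.\<close>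

lemma openin_imp_AB_setin:
  assumes "openin X U"
  shows "AB_setin X U"
proof -
  have "U = U \<inter> topspace X"
    using openin_subset[OF assms] by (simp add: Int_absorb2)
  then show ?thesis
    using assms semi_regularin_topspace unfolding AB_setin_def by metis
qed

lemma openin_imp_preopenin:
  assumes "openin X U"
  shows "preopenin X U"
  unfolding preopenin_def
  using assms by (intro interior_of_maximal closure_of_subset openin_subset)

lemma closedin_imp_preclosedin:
  assumes "closedin X A"
  shows "preclosedin X A"
  using assms by (simp add: preclosedin_def closedin_def openin_imp_preopenin)

text \<open>For closed \<open>A\<close> the closure in \<open>preopenin\<close> is \<open>A\<close>
  itself, so \<open>A\<close> lies in its own interior. Applied to complements, this gives the next
  lemma.\<close>

lemma closedin_preopenin_imp_openin:
  assumes "closedin X A" "preopenin X A"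
  shows "openin X A"
proof -
  have "A \<subseteq> X interior_of A"
    using assms by (simp add: preopenin_def closure_of_closedin)
  then have "X interior_of A = A"
    by (intro equalityI interior_of_subset)
  then show ?thesis
    by (simp only: interior_of_eq)
qed

lemma openin_preclosedin_imp_closedin:
  assumes "openin X A" "preclosedin X A"
  shows "closedin X A"
  using assms closedin_preopenin_imp_openin[of X "topspace X - A"]
  by (auto simp: preclosedin_def closedin_def)

lemma partition_space_semi_openin_imp_openin:
  assumes "partition_space X" "semi_openin X A"
  shows "openin X A"
proof -
  \<comment> \<open>The only use of the partition hypothesis: the interior equals its closure, which
    contains \<open>A\<close>.\<close>
  have "closedin X (X interior_of A)"
    using assms(1) by (simp add: partition_space_def)
  then have "A \<subseteq> X interior_of A"
    using assms(2) by (simp add: semi_openin_def closure_of_closedin)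
  then have "X interior_of A = A"
    by (intro equalityI interior_of_subset)
  then show ?thesis
    by (simp only: interior_of_eq)
qed

lemma partition_space_AB_setin_imp_clopen:
  assumes "partition_space X" "AB_setin X A"
  shows "openin X A \<and> closedin X A"
proof -
  obtain U V where "openin X U" "semi_openin X V" "A = U \<inter> V"
    using assms(2) by (auto simp: AB_setin_def semi_regularin_def)
  then have "openin X A"
    using partition_space_semi_openin_imp_openin[OF assms(1)] by (simp add: openin_Int)
  then show ?thesis
    using assms(1) by (simp add: partition_space_def)
qed

lemma AB_setin_preclosedin_imp_partition_space:
  assumes "\<And>A. AB_setin X A \<Longrightarrow> preclosedin X A"
  shows "partition_space X"
  by (simp add: partition_space_def assms openin_imp_AB_setin openin_preclosedin_imp_closedin)

theorem theorem3p3: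
  fixes X :: "'a topology"
  shows "(partition_space X \<longleftrightarrow> (\<forall>A. AB_setin X A \<longrightarrow> openin X A \<and> closedin X A))
    \<and> (partition_space X \<longleftrightarrow> (\<forall>A. AB_setin X A \<longrightarrow> closedin X A))
    \<and> (partition_space X \<longleftrightarrow> (\<forall>A. AB_setin X A \<longrightarrow> preclosedin X A))"
  by (meson partition_space_AB_setin_imp_clopen AB_setin_preclosedin_imp_partition_space
      closedin_imp_preclosedin)

end
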